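(* Let $\triangle ABC$ be an acute-angled triangle in the Euclidean plane, and let $\triangle DEF$ be the triangle of smallest perimeter inscribed in $\triangle ABC$, with $D$ on side $BC$, $E$ on side $CA$ and $F$ on side $AB$. Then $\triangle DEF$ is a right triangle if and only if exactly one of the angles of $\triangle ABC$ equals $\frac{\pi}{4}$. In addition, in this case the right angle of $\triangle DEF$ and the $\frac{\pi}{4}$ angle of $\triangle ABC$ are opposite angles, i.e. the vertex of the right angle of $\triangle DEF$ lies on the side of $\triangle ABC$ opposite to the vertex at which $\triangle ABC$ has the angle $\frac{\pi}{4}$; thus, if the right angle of $\triangle DEF$ is $\angle E = \angle DEF=\frac{\pi}{2}$, then $\angle B = \angle ABC=\frac{\pi}{4}$.
   Context: A triangle $\triangle DEF$ is inscribed in $\triangle ABC$ if it has one vertex on each side of $\triangle ABC$: $D$ on the segment $BC$, $E$ on the segment $CA$, $F$ on the segment $AB$. The inscribed triangle of smallest perimeter is the one minimizing $DE+EF+FD$ over all such choices of $D,E,F$. For an acute triangle it is a known fact (the solution of Fagnano's problem) that this minimizer exists, is unique, and is the orthic triangle, whose vertices $D,E,F$ are the feet of the altitudes from $A,B,C$ respectively. *)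

theory Defs
  imports "HOL-Analysis.Analysis"
begin

text \<open>
  \<open>vertex_angle P Q R\<close> is the unoriented angle \<open>\<angle>PQR\<close>, with its vertex at the middle argument.
  It is meaningful only for \<open>P \<noteq> Q\<close> and \<open>R \<noteq> Q\<close>: otherwise division by zero gives the junk value
  \<open>arccos 0 = pi/2\<close>. Hence the predicates below require nondegeneracy explicitly.
\<close>

definition vertex_angle :: "real^2 \<Rightarrow> real^2 \<Rightarrow> real^2 \<Rightarrow> real" where
  "vertex_angle P Q R = arccos (((P - Q) \<bullet> (R - Q)) / (norm (P - Q) * norm (R - Q)))"

definition triangle_angles :: "real^2 \<Rightarrow> real^2 \<Rightarrow> real^2 \<Rightarrow> real list" where
  "triangle_angles A B C = [vertex_angle C A B, vertex_angle A B C, vertex_angle B C A]"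

definition acute_triangle :: "real^2 \<Rightarrow> real^2 \<Rightarrow> real^2 \<Rightarrow> bool" where
  "acute_triangle A B C \<longleftrightarrow>
     \<not> collinear {A, B, C} \<and> (\<forall>\<theta> \<in> set (triangle_angles A B C). \<theta> < pi / 2)"

definition right_triangle :: "real^2 \<Rightarrow> real^2 \<Rightarrow> real^2 \<Rightarrow> bool" where
  "right_triangle A B C \<longleftrightarrow>
     \<not> collinear {A, B, C} \<and> (\<exists>\<theta> \<in> set (triangle_angles A B C). \<theta> = pi / 2)"

definition perimeter :: "real^2 \<Rightarrow> real^2 \<Rightarrow> real^2 \<Rightarrow> real" where
  "perimeter D E F = dist D E + dist E F + dist F D"

text \<open>
  The sides are closed segments, and degenerate choices of \<open>D, E, F\<close> are admitted as competitors
  for the smallest perimeter.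
\<close>

definition inscribed_in ::
    "real^2 \<Rightarrow> real^2 \<Rightarrow> real^2 \<Rightarrow> real^2 \<Rightarrow> real^2 \<Rightarrow> real^2 \<Rightarrow> bool" where
  "inscribed_in A B C D E F \<longleftrightarrow>
     D \<in> closed_segment B C \<and> E \<in> closed_segment C A \<and> F \<in> closed_segment A B"

definition min_inscribed ::
    "real^2 \<Rightarrow> real^2 \<Rightarrow> real^2 \<Rightarrow> real^2 \<Rightarrow> real^2 \<Rightarrow> real^2 \<Rightarrow> bool" where
  "min_inscribed A B C D E F \<longleftrightarrow>
     is_arg_min (\<lambda>(X, Y, Z). perimeter X Y Z) (\<lambda>(X, Y, Z). inscribed_in A B C X Y Z) (D, E, F)"

end

theory Submission
  imports Defs
begin

text \<open>
  Let \<open>u, v, w\<close> be the unit vectors along the sides of the orthic triangle. The perimeter of an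
  inscribed triangle is at least \<open>(D - E) \<bullet> u + (E - F) \<bullet> v + (F - D) \<bullet> w\<close>. By the reflection law,
  \<open>u - w\<close>, \<open>v - u\<close>, \<open>w - v\<close> are orthogonal to the sides of \<open>ABC\<close>, so this bound does not depend on
  \<open>D, E, F\<close>, and the orthic triangle attains it. Hence every minimizer has its sides directed
  along \<open>u, v, w\<close>, and its angles follow from \<open>u \<bullet> w = 2 (cos A)\<^sup>2 - 1\<close> and its cyclic analogues.
\<close>

section \<open>Angles and their cosines\<close>

lemma abs_inner_div_norms_le_1:
  fixes x y :: "'a::real_inner"
  shows "\<bar>x \<bullet> y / (norm x * norm y)\<bar> \<le> 1"
proof (cases "norm x * norm y = 0")
  case True
  then show ?thesis
    by auto
next
  case False
  then have "0 < norm x * norm y"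
    by simp
  then show ?thesis
    using Cauchy_Schwarz_ineq2[of x y] by (simp add: abs_mult)
qed

lemma cos_vertex_angle:
  "cos (vertex_angle P Q R) = ((P - Q) \<bullet> (R - Q)) / (norm (P - Q) * norm (R - Q))"
  unfolding vertex_angle_def by (rule cos_arccos_abs[OF abs_inner_div_norms_le_1])

lemma vertex_angle_bounds: "0 \<le> vertex_angle P Q R" "vertex_angle P Q R \<le> pi"
proof -
  have "- 1 \<le> (P - Q) \<bullet> (R - Q) / (norm (P - Q) * norm (R - Q))"
    "(P - Q) \<bullet> (R - Q) / (norm (P - Q) * norm (R - Q)) \<le> 1"
    using abs_inner_div_norms_le_1[of "P - Q" "R - Q"] by linarith+
  then show "0 \<le> vertex_angle P Q R" "vertex_angle P Q R \<le> pi"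
    unfolding vertex_angle_def by (rule arccos_lbound, rule arccos_ubound)
qed

text \<open>A degenerate angle has the junk value \<open>pi / 2\<close>, so acuteness also excludes
  coinciding points; the inner product has the sign of the cosine.\<close>

lemma inner_pos_if_vertex_angle_acute:
  assumes "vertex_angle P Q R < pi / 2"
  shows "0 < (P - Q) \<bullet> (R - Q)"
proof -
  have "0 < cos (vertex_angle P Q R)"
    using assms vertex_angle_bounds(1)[of P Q R] by (intro cos_gt_zero_pi) auto
  then show ?thesis
    unfolding cos_vertex_angle
    by (metis divide_nonpos_nonneg mult_nonneg_nonneg norm_ge_zero not_le)
qed

lemma vertex_angle_eq_iff:
  assumes "0 \<le> t" "t \<le> pi"
  shows "vertex_angle P Q R = t \<longleftrightarrow> cos (vertex_angle P Q R) = cos t"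
  using cos_inj_pi[OF vertex_angle_bounds[of P Q R] assms] by auto

lemma vertex_angle_eq_pi_half_iff:
  assumes "P \<noteq> Q" "R \<noteq> Q"
  shows "vertex_angle P Q R = pi / 2 \<longleftrightarrow> (P - Q) \<bullet> (R - Q) = 0"
  using assms by (subst vertex_angle_eq_iff) (auto simp: cos_vertex_angle)

text \<open>Squaring the cosine removes \<open>sqrt 2\<close>; the positive inner product rules out
  the other solution \<open>3 * pi / 4\<close>.\<close>

lemma vertex_angle_eq_pi_quarter_iff:
  assumes "0 < (P - Q) \<bullet> (R - Q)"
  shows "vertex_angle P Q R = pi / 4 \<longleftrightarrow>
    2 * ((P - Q) \<bullet> (R - Q))\<^sup>2 = (norm (P - Q) * norm (R - Q))\<^sup>2"
proof -
  define m where "m = norm (P - Q) * norm (R - Q)"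
  have m: "0 < m"
    using assms unfolding m_def by (auto simp: zero_less_mult_iff)
  define c where "c = (P - Q) \<bullet> (R - Q) / m"
  have c: "0 < c"
    using assms m by (simp add: c_def)
  have "vertex_angle P Q R = pi / 4 \<longleftrightarrow> c = sqrt 2 / 2"
    by (subst vertex_angle_eq_iff) (auto simp: cos_vertex_angle cos_45 c_def m_def)
  also have "\<dots> \<longleftrightarrow> c\<^sup>2 = (sqrt 2 / 2)\<^sup>2"
    using c by (simp add: power2_eq_iff_nonneg)
  also have "\<dots> \<longleftrightarrow> 2 * ((P - Q) \<bullet> (R - Q))\<^sup>2 = m\<^sup>2"
    using m by (auto simp: c_def power_divide field_simps)
  finally show ?thesis
    unfolding m_def .
qed

section \<open>Unit directions along the sides of the orthic triangle\<close>

text \<open>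
  For acute \<open>ABC\<close>, this is the unit vector from the foot \<open>E\<close> of the altitude through \<open>B\<close> to the foot
  \<open>D\<close> of the altitude through \<open>A\<close>: the distances \<open>CD\<close> and \<open>CE\<close> are inversely proportional to \<open>BC\<close>
  and \<open>CA\<close>, which explains the coefficients.
\<close>

definition orthic_dir :: "'a::real_inner \<Rightarrow> 'a \<Rightarrow> 'a \<Rightarrow> 'a" where
  "orthic_dir A B C =
    (norm (A - C) / (norm (B - C) * norm (A - B))) *\<^sub>R (B - C) -
    (norm (B - C) / (norm (A - C) * norm (A - B))) *\<^sub>R (A - C)"

text \<open>The squared norm expands to \<open>(p^2 + q^2 - 2 * g) / r^2\<close>, which is 1 by the
  law of cosines.\<close>

lemma norm_orthic_dir:
  fixes A B C :: "'a::real_inner"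
  assumes "A \<noteq> B" "B \<noteq> C" "C \<noteq> A"
  shows "norm (orthic_dir A B C) = 1"
proof -
  define p q r g where "p = norm (B - C)" and "q = norm (A - C)" and "r = norm (A - B)"
    and "g = (B - C) \<bullet> (A - C)"
  have pos: "0 < p" "0 < q" "0 < r"
    using assms by (auto simp: p_def q_def r_def)
  have r2: "r\<^sup>2 = p\<^sup>2 + q\<^sup>2 - 2 * g"
    by (simp add: p_def q_def r_def g_def power2_norm_eq_inner inner_diff_left inner_diff_right
        inner_commute)
  have ip: "(B - C) \<bullet> (B - C) = p\<^sup>2" "(A - C) \<bullet> (A - C) = q\<^sup>2"
    "(B - C) \<bullet> (A - C) = g" "(A - C) \<bullet> (B - C) = g"
    by (simp_all add: p_def q_def g_def power2_norm_eq_inner inner_commute)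
  have "(norm (orthic_dir A B C))\<^sup>2 =
      (q / (p * r))\<^sup>2 * p\<^sup>2 + (p / (q * r))\<^sup>2 * q\<^sup>2 - 2 * (q / (p * r)) * (p / (q * r)) * g"
    unfolding orthic_dir_def power2_norm_eq_inner p_def[symmetric] q_def[symmetric] r_def[symmetric]
    unfolding inner_diff_left[of "_ *\<^sub>R _"] inner_diff_right[of _ "_ *\<^sub>R _"]
    unfolding inner_scaleR_left inner_scaleR_right ip
    by (simp add: power2_eq_square algebra_simps)
  also have "\<dots> = (p\<^sup>2 + q\<^sup>2 - 2 * g) / r\<^sup>2"
    using pos by (simp add: field_simps power2_eq_square)
  also have "\<dots> = 1"
    using pos r2[symmetric] by simp
  finally have "(norm (orthic_dir A B C))\<^sup>2 = 1\<^sup>2"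
    by simp
  then show ?thesis
    by (rule power2_eq_imp_eq) simp_all
qed

text \<open>Both inner products equal -|BC| cos A. For acute ABC this is the reflection law at the
  foot on BC: the direction arriving from the foot on CA and the one leaving towards the foot on AB
  have equal components along BC.\<close>

lemma orthic_dir_inner_side:
  fixes A B C :: "'a::real_inner"
  assumes "A \<noteq> B" "B \<noteq> C" "C \<noteq> A"
  shows "orthic_dir A B C \<bullet> (C - B) =
    - norm (B - C) * ((B - A) \<bullet> (C - A)) / (norm (A - B) * norm (A - C))"
  and "orthic_dir C A B \<bullet> (C - B) =
    - norm (B - C) * ((B - A) \<bullet> (C - A)) / (norm (A - B) * norm (A - C))"
proof -
  define p q r a where "p = norm (B - C)" and "q = norm (A - C)" and "r = norm (A - B)"
    and "a = (B - A) \<bullet> (C - A)"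
  have pos: "0 < p" "0 < q" "0 < r"
    using assms by (auto simp: p_def q_def r_def)
  have sym: "norm (C - B) = p" "norm (C - A) = q"
    by (simp_all add: p_def q_def norm_minus_commute)
  have ip: "(B - C) \<bullet> (C - B) = - p\<^sup>2" "(A - C) \<bullet> (C - B) = a - q\<^sup>2"
    "(A - B) \<bullet> (C - B) = r\<^sup>2 - a" "(C - B) \<bullet> (C - B) = p\<^sup>2"
    by (simp_all add: p_def q_def r_def a_def power2_norm_eq_inner inner_diff_left inner_diff_right
        inner_commute)
  show "orthic_dir A B C \<bullet> (C - B) =
      - norm (B - C) * ((B - A) \<bullet> (C - A)) / (norm (A - B) * norm (A - C))"
    unfolding orthic_dir_def p_def[symmetric] q_def[symmetric] r_def[symmetric] a_def[symmetric]
    unfolding inner_diff_left[of "_ *\<^sub>R _"] inner_scaleR_left ip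
    using pos by (simp add: field_simps power2_eq_square)
  show "orthic_dir C A B \<bullet> (C - B) =
      - norm (B - C) * ((B - A) \<bullet> (C - A)) / (norm (A - B) * norm (A - C))"
    unfolding orthic_dir_def sym p_def[symmetric] q_def[symmetric] r_def[symmetric] a_def[symmetric]
    unfolding inner_diff_left[of "_ *\<^sub>R _"] inner_scaleR_left ip
    using pos by (simp add: field_simps power2_eq_square)
qed

text \<open>The value is cos (2 A): the direction turns by 2 A at the foot on BC, so for acute ABC
  the orthic triangle has the interior angle pi - 2 A there.\<close>

lemma orthic_dir_inner_orthic_dir:
  fixes A B C :: "'a::real_inner"
  assumes "A \<noteq> B" "B \<noteq> C" "C \<noteq> A"
  shows "orthic_dir A B C \<bullet> orthic_dir C A B =
    2 * ((B - A) \<bullet> (C - A))\<^sup>2 / (norm (B - A) * norm (C - A))\<^sup>2 - 1"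
proof -
  define p q r a b c where "p = norm (B - C)" and "q = norm (A - C)" and "r = norm (A - B)"
    and "a = (B - A) \<bullet> (C - A)" and "b = (A - B) \<bullet> (C - B)" and "c = (A - C) \<bullet> (B - C)"
  have pos: "0 < p" "0 < q" "0 < r"
    using assms by (auto simp: p_def q_def r_def)
  have sym: "norm (C - B) = p" "norm (C - A) = q" "norm (B - A) = r"
    by (simp_all add: p_def q_def r_def norm_minus_commute)
  \<comment> \<open>All squared side lengths are sums of the inner products at the vertices, which
    turns the claim into a polynomial identity in \<open>a\<close>, \<open>b\<close>,
    \<open>c\<close>.\<close>
  have p2: "p\<^sup>2 = b + c" and q2: "q\<^sup>2 = a + c" and r2: "r\<^sup>2 = a + b"
    by (simp_all add: p_def q_def r_def a_def b_def c_def power2_norm_eq_inner inner_diff_left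
        inner_diff_right inner_commute)
  have ip: "(B - C) \<bullet> (A - B) = - b" "(B - C) \<bullet> (C - B) = - p\<^sup>2"
    "(A - C) \<bullet> (A - B) = a" "(A - C) \<bullet> (C - B) = - c"
    by (simp_all add: p_def a_def b_def c_def power2_norm_eq_inner inner_diff_left inner_diff_right
        inner_commute)
  have "orthic_dir A B C \<bullet> orthic_dir C A B =
      q / (p * r) * (p / (r * q) * (- b) - r / (p * q) * (- p\<^sup>2)) -
      p / (q * r) * (p / (r * q) * a - r / (p * q) * (- c))"
    unfolding orthic_dir_def sym p_def[symmetric] q_def[symmetric] r_def[symmetric]
    unfolding inner_diff_left[of "_ *\<^sub>R _"] inner_diff_right[of _ "_ *\<^sub>R _"]
    unfolding inner_scaleR_left inner_scaleR_right ip
    by (simp add: algebra_simps)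
  also have "\<dots> = (q\<^sup>2 * r\<^sup>2 - q\<^sup>2 * b - p\<^sup>2 * a - r\<^sup>2 * c) / (q\<^sup>2 * r\<^sup>2)"
    using pos by (simp add: field_simps power2_eq_square)
  also have "\<dots> = (2 * a\<^sup>2 - q\<^sup>2 * r\<^sup>2) / (q\<^sup>2 * r\<^sup>2)"
    unfolding p2 q2 r2 by (simp add: algebra_simps power2_eq_square)
  also have "\<dots> = 2 * a\<^sup>2 / (r * q)\<^sup>2 - 1"
    using pos by (simp add: field_simps)
  finally show ?thesis
    unfolding a_def sym .
qed

section \<open>Feet of the altitudes\<close>

definition altitude_foot :: "'a::real_inner \<Rightarrow> 'a \<Rightarrow> 'a \<Rightarrow> 'a" where
  "altitude_foot A B C = C + (((A - C) \<bullet> (B - C)) / (norm (B - C))\<^sup>2) *\<^sub>R (B - C)"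

text \<open>The coefficients measured from C and from B add up to 1. This lets the feet on BC and CA
  both be measured from their common vertex C.\<close>

lemma altitude_foot_commute:
  fixes A B C :: "'a::real_inner"
  assumes "B \<noteq> C"
  shows "altitude_foot A B C = altitude_foot A C B"
proof -
  define s where "s = ((A - C) \<bullet> (B - C)) / (norm (B - C))\<^sup>2"
  have "(A - C) \<bullet> (B - C) + (A - B) \<bullet> (C - B) = (norm (B - C))\<^sup>2"
    by (simp add: power2_norm_eq_inner inner_diff_left inner_diff_right inner_commute)
  then have "((A - B) \<bullet> (C - B)) / (norm (C - B))\<^sup>2 = 1 - s"
    using assms by (simp add: s_def norm_minus_commute field_simps)
  then have "altitude_foot A C B = B + (1 - s) *\<^sub>R (C - B)"
    by (simp add: altitude_foot_def)
  then show ?thesis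
    unfolding altitude_foot_def s_def[symmetric] by (simp add: algebra_simps)
qed

text \<open>The two positive inner products add up to |BC|^2, so the coefficient of the foot lies
  between 0 and 1.\<close>

lemma altitude_foot_in_segment:
  fixes A B C :: "'a::real_inner"
  assumes "B \<noteq> C" "0 < (A - B) \<bullet> (C - B)" "0 < (A - C) \<bullet> (B - C)"
  shows "altitude_foot A B C \<in> closed_segment B C"
proof -
  define s where "s = ((A - C) \<bullet> (B - C)) / (norm (B - C))\<^sup>2"
  have "(A - C) \<bullet> (B - C) + (A - B) \<bullet> (C - B) = (norm (B - C))\<^sup>2"
    by (simp add: power2_norm_eq_inner inner_diff_left inner_diff_right inner_commute)
  then have "0 \<le> s" "s \<le> 1"
    using assms by (auto simp: s_def divide_le_eq)
  moreover have "altitude_foot A B C = (1 - s) *\<^sub>R C + s *\<^sub>R B"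
    unfolding altitude_foot_def s_def[symmetric] by (simp add: algebra_simps)
  ultimately have "altitude_foot A B C \<in> closed_segment C B"
    unfolding closed_segment_def by blast
  then show ?thesis
    by (simp add: closed_segment_commute)
qed

text \<open>The scalar is |AB| cos C, the signed length of this side of the orthic triangle.\<close>

lemma altitude_foot_diff:
  fixes A B C :: "'a::real_inner"
  assumes "A \<noteq> B" "B \<noteq> C" "C \<noteq> A"
  shows "altitude_foot A B C - altitude_foot B C A =
    (norm (A - B) * ((A - C) \<bullet> (B - C)) / (norm (A - C) * norm (B - C))) *\<^sub>R orthic_dir A B C"
proof -
  have "altitude_foot B C A = altitude_foot B A C"
    using assms by (intro altitude_foot_commute) auto
  moreover have "norm (A - B) \<noteq> 0" "norm (B - C) \<noteq> 0" "norm (A - C) \<noteq> 0"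
    using assms by auto
  ultimately show ?thesis
    by (simp add: altitude_foot_def orthic_dir_def scaleR_right_diff_distrib power2_eq_square
        inner_commute)
qed

text \<open>Since the angle at C is acute, the difference of the feet is a positive multiple of the
  unit vector \<open>orthic_dir A B C\<close>: the equality case of Cauchy-Schwarz.\<close>

lemma dist_altitude_feet:
  fixes A B C :: "'a::real_inner"
  assumes "A \<noteq> B" "B \<noteq> C" "C \<noteq> A" "0 < (A - C) \<bullet> (B - C)"
  shows "dist (altitude_foot A B C) (altitude_foot B C A) =
    (altitude_foot A B C - altitude_foot B C A) \<bullet> orthic_dir A B C"
proof -
  have "orthic_dir A B C \<bullet> orthic_dir A B C = 1"
    using norm_orthic_dir[of A B C] assms by (simp add: dot_square_norm)
  then show ?thesis
    using assms norm_orthic_dir[of A B C] by (simp add: dist_norm altitude_foot_diff)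
qed

section \<open>Minimality forces the orthic directions\<close>

text \<open>Pairing with \<open>n\<close> is constant along PQ. With \<open>n\<close> a difference
  of two orthic directions, this makes the lower bound independent of the points chosen on the
  sides.\<close>

lemma inner_eq_on_segment:
  fixes n :: "'a::real_inner"
  assumes "X \<in> closed_segment P Q" "Y \<in> closed_segment P Q" "n \<bullet> (Q - P) = 0"
  shows "X \<bullet> n = Y \<bullet> n"
proof -
  have "Z \<bullet> n = P \<bullet> n" if Z: "Z \<in> closed_segment P Q" for Z
  proof -
    obtain t where "Z = P + t *\<^sub>R (Q - P)"
      using Z by (auto simp: closed_segment_def algebra_simps)
    then show ?thesis
      using assms(3) by (metis inner_add_left inner_scaleR_left inner_commute mult_zero_right add_0_right)
  qed
  from this[OF assms(1)] this[OF assms(2)] show ?thesis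
    by simp
qed

text \<open>Equality case of Cauchy-Schwarz; it recovers the direction of each side of a
  minimizer.\<close>

lemma norm_eq_inner_unitD:
  fixes x u :: "'a::real_inner"
  assumes "norm u = 1" "x \<bullet> u = norm x"
  shows "x = norm x *\<^sub>R u"
  using assms norm_cauchy_schwarz_eq[of x u] by simp

text \<open>The next lemma is Fagnano's theorem in a form that suffices for computing angles.\<close>

lemma min_inscribed_directions:
  assumes nc: "\<not> collinear {A, B, C}"
    and pos: "0 < (B - A) \<bullet> (C - A)" "0 < (C - B) \<bullet> (A - B)" "0 < (A - C) \<bullet> (B - C)"
    and min: "min_inscribed A B C D E F"
  shows "D - E = norm (D - E) *\<^sub>R orthic_dir A B C"
    and "E - F = norm (E - F) *\<^sub>R orthic_dir B C A"
    and "F - D = norm (F - D) *\<^sub>R orthic_dir C A B"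
proof -
  define u v w where "u = orthic_dir A B C" and "v = orthic_dir B C A" and "w = orthic_dir C A B"
  define D' E' F' where "D' = altitude_foot A B C" and "E' = altitude_foot B C A"
    and "F' = altitude_foot C A B"
  have ne: "A \<noteq> B" "B \<noteq> C" "C \<noteq> A"
    using nc by (auto simp: insert_commute)
  have unit: "norm u = 1" "norm v = 1" "norm w = 1"
    using ne by (simp_all add: u_def v_def w_def norm_orthic_dir)
  have le: "\<not> perimeter X Y Z < perimeter D E F" if "inscribed_in A B C X Y Z" for X Y Z
    using min that unfolding min_inscribed_def is_arg_min_def by auto
  \<comment> \<open>Acuteness places the feet on the closed sides, so the orthic triangle is an
    admissible competitor.\<close>
  have ins': "inscribed_in A B C D' E' F'"
    unfolding inscribed_in_def D'_def E'_def F'_def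
    using ne pos by (auto intro!: altitude_foot_in_segment simp: inner_commute)
  have ins: "inscribed_in A B C D E F"
    using min unfolding min_inscribed_def is_arg_min_def by auto
  have perp: "(u - w) \<bullet> (C - B) = 0" "(v - u) \<bullet> (A - C) = 0" "(w - v) \<bullet> (B - A) = 0"
    using ne by (simp_all add: u_def v_def w_def inner_diff_left orthic_dir_inner_side)
  have const: "(D - E) \<bullet> u + (E - F) \<bullet> v + (F - D) \<bullet> w =
      (D' - E') \<bullet> u + (E' - F') \<bullet> v + (F' - D') \<bullet> w"
  proof -
    \<comment> \<open>The sum over sides is regrouped by vertices, so that each vertex is paired
      with a vector normal to its own side.\<close>
    have "D \<bullet> (u - w) = D' \<bullet> (u - w)" "E \<bullet> (v - u) = E' \<bullet> (v - u)" "F \<bullet> (w - v) = F' \<bullet> (w - v)"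
      using ins ins' perp unfolding inscribed_in_def by (auto intro: inner_eq_on_segment)
    then show ?thesis
      by (simp add: inner_diff_left inner_diff_right)
  qed
  have "perimeter D E F \<le> perimeter D' E' F'"
    using le[OF ins'] by simp
  also have "\<dots> = (D' - E') \<bullet> u + (E' - F') \<bullet> v + (F' - D') \<bullet> w"
    unfolding perimeter_def D'_def E'_def F'_def u_def v_def w_def
    using ne pos by (simp add: dist_altitude_feet inner_commute)
  finally have "norm (D - E) + norm (E - F) + norm (F - D) \<le>
      (D - E) \<bullet> u + (E - F) \<bullet> v + (F - D) \<bullet> w"
    using const by (simp add: perimeter_def dist_norm)
  moreover have "(D - E) \<bullet> u \<le> norm (D - E)" "(E - F) \<bullet> v \<le> norm (E - F)"
    "(F - D) \<bullet> w \<le> norm (F - D)"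
    using unit norm_cauchy_schwarz[of "D - E" u] norm_cauchy_schwarz[of "E - F" v]
      norm_cauchy_schwarz[of "F - D" w] by simp_all
  \<comment> \<open>Three termwise inequalities whose sum also holds in reverse must all be
    equalities.\<close>
  ultimately have "(D - E) \<bullet> u = norm (D - E)" "(E - F) \<bullet> v = norm (E - F)"
    "(F - D) \<bullet> w = norm (F - D)"
    by linarith+
  then show "D - E = norm (D - E) *\<^sub>R orthic_dir A B C"
    "E - F = norm (E - F) *\<^sub>R orthic_dir B C A"
    "F - D = norm (F - D) *\<^sub>R orthic_dir C A B"
    using unit norm_eq_inner_unitD unfolding u_def v_def w_def by blast+
qed

section \<open>Tools for the nondegeneracy of a minimizer\<close>

text \<open>A point of BC and CA other than C would make these lines coincide, and C itself is not
  on AB. This excludes D = E = F.\<close>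

lemma sides_have_no_common_point:
  fixes A B C :: "'a::euclidean_space"
  assumes "\<not> collinear {A, B, C}"
  shows "\<not> (X \<in> closed_segment B C \<and> X \<in> closed_segment C A \<and> X \<in> closed_segment A B)"
proof
  assume X: "X \<in> closed_segment B C \<and> X \<in> closed_segment C A \<and> X \<in> closed_segment A B"
  then have col: "collinear {B, C, X}" "collinear {C, X, A}" "collinear {A, B, X}"
    by (auto simp: between_mem_segment[symmetric] insert_commute
        dest!: between_imp_collinear)
  show False
  proof (cases "X = C")
    case True
    then show ?thesis
      using col(3) assms by simp
  next
    case False
    then have "collinear {B, C, A}"
      using col(1,2) collinear_3_trans by metis
    then show ?thesis
      using assms by (simp add: insert_commute)
  qed
qed

lemma collinear_iff_abs_inner:
  fixes A B C :: "'a::euclidean_space"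
  shows "collinear {A, B, C} \<longleftrightarrow> \<bar>(B - A) \<bullet> (C - A)\<bar> = norm (B - A) * norm (C - A)"
proof -
  have "collinear {A, B, C} \<longleftrightarrow> collinear {0, B - A, C - A}"
    using collinear_3[of B A C] by (simp add: insert_commute NO_MATCH_def)
  then show ?thesis
    by (simp add: norm_cauchy_schwarz_equal)
qed

lemma cauchy_schwarz_strict:
  fixes A B C :: "'a::euclidean_space"
  assumes "\<not> collinear {A, B, C}"
  shows "((B - A) \<bullet> (C - A))\<^sup>2 < (norm (B - A) * norm (C - A))\<^sup>2"
proof -
  have "\<bar>(B - A) \<bullet> (C - A)\<bar> \<noteq> norm (B - A) * norm (C - A)"
    using assms by (simp add: collinear_iff_abs_inner)
  then have "\<bar>(B - A) \<bullet> (C - A)\<bar> < norm (B - A) * norm (C - A)"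
    using Cauchy_Schwarz_ineq2[of "B - A" "C - A"] by linarith
  then show ?thesis
    by (metis abs_ge_zero power2_abs power_strict_mono pos2)
qed

text \<open>The inner product is cos (2 A), and 0 < (cos A)^2 < 1: acuteness gives the lower bound,
  noncollinearity the upper. So the two directions are not parallel.\<close>

lemma orthic_dir_inner_bounds:
  fixes A B C :: "'a::euclidean_space"
  assumes "\<not> collinear {A, B, C}" "0 < (B - A) \<bullet> (C - A)"
  shows "\<bar>orthic_dir A B C \<bullet> orthic_dir C A B\<bar> < 1"
proof -
  have ne: "A \<noteq> B" "B \<noteq> C" "C \<noteq> A"
    using assms by (auto simp: insert_commute)
  have "0 < ((B - A) \<bullet> (C - A))\<^sup>2 / (norm (B - A) * norm (C - A))\<^sup>2"
    "((B - A) \<bullet> (C - A))\<^sup>2 / (norm (B - A) * norm (C - A))\<^sup>2 < 1"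
    using assms(2) ne cauchy_schwarz_strict[OF assms(1)] by (auto simp: divide_less_eq)
  then show ?thesis
    unfolding orthic_dir_inner_orthic_dir[OF ne] by (simp add: abs_less_iff)
qed

text \<open>Pairing with \<open>x\<close> and \<open>y\<close> and eliminating \<open>t\<close>
  leaves \<open>s\<close> times the Gram determinant, which is positive.\<close>

lemma eq_0_if_scaleR_unit_sum_eq_0:
  fixes x y :: "'a::real_inner"
  assumes "norm x = 1" "norm y = 1" "\<bar>x \<bullet> y\<bar> < 1" "s *\<^sub>R x + t *\<^sub>R y = 0"
  shows "s = 0"
proof -
  have xx: "x \<bullet> x = 1" and yy: "y \<bullet> y = 1"
    using assms by (simp_all add: dot_square_norm)
  have "(s *\<^sub>R x + t *\<^sub>R y) \<bullet> x = 0" "(s *\<^sub>R x + t *\<^sub>R y) \<bullet> y = 0"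
    using assms(4) by simp_all
  then have "s + t * (x \<bullet> y) = 0" "s * (x \<bullet> y) + t = 0"
    using xx yy by (simp_all add: inner_add_left inner_commute[of y x])
  then have "s * (1 - (x \<bullet> y)\<^sup>2) = 0"
    by algebra
  moreover have "(x \<bullet> y)\<^sup>2 < 1"
    using assms(3) by (simp add: abs_square_less_1)
  ultimately show ?thesis
    by simp
qed

section \<open>Right angles of the minimizer and angles pi/4 of ABC\<close>

text \<open>Minimality yields only the directions of the sides, so nonzero lengths must be proved
  before angles can be read off. The angle at D is then right iff cos (2 A) = 0, which for acute A
  means A = pi/4.\<close>

lemma min_inscribed_corner:
  assumes nc: "\<not> collinear {A, B, C}"
    and pos: "0 < (B - A) \<bullet> (C - A)" "0 < (C - B) \<bullet> (A - B)" "0 < (A - C) \<bullet> (B - C)"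
    and min: "min_inscribed A B C D E F"
  shows "F \<noteq> D \<and> E \<noteq> D \<and> \<not> collinear {D, E, F} \<and>
    (vertex_angle F D E = pi / 2 \<longleftrightarrow> vertex_angle C A B = pi / 4)"
proof -
  define u v w where "u = orthic_dir A B C" and "v = orthic_dir B C A" and "w = orthic_dir C A B"
  define l m n where "l = norm (D - E)" and "m = norm (E - F)" and "n = norm (F - D)"
  have ne: "A \<noteq> B" "B \<noteq> C" "C \<noteq> A"
    using nc by (auto simp: insert_commute)
  have unit: "norm u = 1" "norm v = 1" "norm w = 1"
    using ne by (simp_all add: u_def v_def w_def norm_orthic_dir)
  have bound: "\<bar>u \<bullet> w\<bar> < 1" "\<bar>v \<bullet> u\<bar> < 1" "\<bar>w \<bullet> v\<bar> < 1"
    using orthic_dir_inner_bounds[of A B C] orthic_dir_inner_bounds[of B C A]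
      orthic_dir_inner_bounds[of C A B] nc pos
    by (simp_all add: u_def v_def w_def insert_commute)
  have dirs: "D - E = l *\<^sub>R u" "E - F = m *\<^sub>R v" "F - D = n *\<^sub>R w"
    using min_inscribed_directions[OF assms] by (simp_all add: u_def v_def w_def l_def m_def n_def)
  have sum0: "l *\<^sub>R u + m *\<^sub>R v + n *\<^sub>R w = 0"
    unfolding dirs[symmetric] by simp
  have ins: "inscribed_in A B C D E F"
    using min unfolding min_inscribed_def is_arg_min_def by auto
  have not_all: "\<not> (D = E \<and> E = F)"
    using sides_have_no_common_point[OF nc] ins unfolding inscribed_in_def by blast
  \<comment> \<open>If DE collapses, closing up the triangle leaves a relation between the
    independent \<open>w\<close> and \<open>v\<close>; then FD collapses too and all vertices
    coincide.\<close>
  have l: "l \<noteq> 0"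
  proof
    assume "l = 0"
    then have "n *\<^sub>R w + m *\<^sub>R v = 0"
      using sum0 by (simp add: add.commute)
    then have "n = 0"
      using eq_0_if_scaleR_unit_sum_eq_0 unit bound by blast
    then show False
      using not_all \<open>l = 0\<close> by (auto simp: l_def n_def)
  qed
  have n: "n \<noteq> 0"
  proof
    assume "n = 0"
    then have "m *\<^sub>R v + l *\<^sub>R u = 0"
      using sum0 by (simp add: add.commute)
    then have "m = 0"
      using eq_0_if_scaleR_unit_sum_eq_0 unit bound by blast
    then show False
      using not_all \<open>n = 0\<close> by (auto simp: m_def n_def)
  qed
  have neD: "F \<noteq> D" "E \<noteq> D"
    using l n by (auto simp: l_def n_def)
  \<comment> \<open>The rays at D point along \<open>- u\<close> and \<open>w\<close>, so the
    interior angle is the supplement of the angle between \<open>u\<close> and \<open>w\<close>;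
    orthogonality does not see the sign.\<close>
  have ED: "E - D = - (l *\<^sub>R u)"
    unfolding dirs(1)[symmetric] by simp
  have "\<not> collinear {D, E, F}"
  proof
    assume "collinear {D, E, F}"
    then have "\<bar>(E - D) \<bullet> (F - D)\<bar> = norm (E - D) * norm (F - D)"
      by (simp add: collinear_iff_abs_inner)
    then have "\<bar>l\<bar> * \<bar>n\<bar> * \<bar>u \<bullet> w\<bar> = \<bar>l\<bar> * \<bar>n\<bar>"
      using unit by (auto simp: ED dirs(3) abs_mult)
    then show False
      using l n bound by simp
  qed
  moreover have "vertex_angle F D E = pi / 2 \<longleftrightarrow> vertex_angle C A B = pi / 4"
  proof -
    have "vertex_angle F D E = pi / 2 \<longleftrightarrow> (F - D) \<bullet> (E - D) = 0"
      using neD by (rule vertex_angle_eq_pi_half_iff)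
    also have "\<dots> \<longleftrightarrow> u \<bullet> w = 0"
      using l n by (simp add: ED dirs(3) inner_commute[of w u])
    also have "\<dots> \<longleftrightarrow> 2 * ((B - A) \<bullet> (C - A))\<^sup>2 = (norm (B - A) * norm (C - A))\<^sup>2"
      unfolding u_def w_def orthic_dir_inner_orthic_dir[OF ne] using ne by auto
    also have "\<dots> \<longleftrightarrow> vertex_angle C A B = pi / 4"
      using pos(1) vertex_angle_eq_pi_quarter_iff[of C A B] by (simp add: inner_commute mult.commute)
    finally show ?thesis .
  qed
  ultimately show ?thesis
    using neD by blast
qed

section \<open>Cyclic symmetry and the number of angles pi/4\<close>

text \<open>Perimeter and inscribedness are invariant under cyclic relabelling, so results about the
  corner D carry over to E and F.\<close>

lemma min_inscribed_rotate:
  assumes "min_inscribed A B C D E F"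
  shows "min_inscribed B C A E F D"
proof -
  have le: "\<not> perimeter X Y Z < perimeter D E F" if "inscribed_in A B C X Y Z" for X Y Z
    using assms that unfolding min_inscribed_def is_arg_min_def by auto
  have "inscribed_in A B C D E F"
    using assms unfolding min_inscribed_def is_arg_min_def by auto
  moreover have "\<not> perimeter Y Z X < perimeter E F D" if "inscribed_in B C A Y Z X" for X Y Z
  proof -
    have "inscribed_in A B C X Y Z"
      using that by (simp add: inscribed_in_def)
    from le[OF this] show ?thesis
      by (simp add: perimeter_def)
  qed
  ultimately show ?thesis
    unfolding min_inscribed_def is_arg_min_def by (auto simp: inscribed_in_def)
qed

text \<open>Two angles of \<open>pi/4\<close> would leave \<open>pi/2\<close> for the third; this avoids the angle sum.\<close>

lemma not_two_pi_quarter: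
  assumes pos: "0 < (B - A) \<bullet> (C - A)" "0 < (C - B) \<bullet> (A - B)" "0 < (A - C) \<bullet> (B - C)"
  shows "\<not> (vertex_angle C A B = pi / 4 \<and> vertex_angle A B C = pi / 4)"
proof
  define a b c where "a = (B - A) \<bullet> (C - A)" and "b = (C - B) \<bullet> (A - B)"
    and "c = (A - C) \<bullet> (B - C)"
  have sq: "(norm (C - A))\<^sup>2 = a + c" "(norm (B - A))\<^sup>2 = a + b" "(norm (A - B))\<^sup>2 = a + b"
    "(norm (C - B))\<^sup>2 = b + c"
    by (simp_all add: a_def b_def c_def power2_norm_eq_inner inner_diff_left inner_diff_right
        inner_commute)
  assume "vertex_angle C A B = pi / 4 \<and> vertex_angle A B C = pi / 4"
  moreover have "(C - A) \<bullet> (B - A) = a" "(A - B) \<bullet> (C - B) = b"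
    by (simp_all add: a_def b_def inner_commute)
  ultimately have "2 * a\<^sup>2 = (a + c) * (a + b)" "2 * b\<^sup>2 = (a + b) * (b + c)"
    using pos vertex_angle_eq_pi_quarter_iff[of C A B] vertex_angle_eq_pi_quarter_iff[of A B C]
    unfolding a_def[symmetric] b_def[symmetric] power_mult_distrib sq by simp_all
  \<comment> \<open>Both equations give the value ab + bc + ca, one for a^2 and one for b^2. Thus a
    = b, which leaves 2ac = 0 although a and c are positive.\<close>
  then have "a\<^sup>2 = b\<^sup>2" "a\<^sup>2 = a * b + a * c + b * c"
    by (simp_all add: algebra_simps power2_eq_square)
  moreover have "0 < a" "0 < b" "0 < c"
    using pos by (simp_all add: a_def b_def c_def)
  ultimately have "a = b" "0 < c"
    by (simp_all add: power2_eq_iff_nonneg)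
  with \<open>a\<^sup>2 = a * b + a * c + b * c\<close> \<open>0 < a\<close> show False
    by (simp add: power2_eq_square)
qed

theorem theorem1p2:
  fixes A B C D E F :: "real^2"
  assumes "acute_triangle A B C"
    and "min_inscribed A B C D E F"
  shows "(right_triangle D E F \<longleftrightarrow>
            length (filter (\<lambda>\<theta>. \<theta> = pi / 4) (triangle_angles A B C)) = 1) \<and>
         (right_triangle D E F \<longrightarrow>
            (vertex_angle F D E = pi / 2 \<longleftrightarrow> vertex_angle C A B = pi / 4) \<and>
            (vertex_angle D E F = pi / 2 \<longleftrightarrow> vertex_angle A B C = pi / 4) \<and>
            (vertex_angle E F D = pi / 2 \<longleftrightarrow> vertex_angle B C A = pi / 4))"
proof -
  have nc: "\<not> collinear {A, B, C}" "\<not> collinear {B, C, A}" "\<not> collinear {C, A, B}"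
    using assms(1) by (simp_all add: acute_triangle_def insert_commute)
  have pos: "0 < (B - A) \<bullet> (C - A)" "0 < (C - B) \<bullet> (A - B)" "0 < (A - C) \<bullet> (B - C)"
    using assms(1) inner_pos_if_vertex_angle_acute[of C A B]
      inner_pos_if_vertex_angle_acute[of A B C] inner_pos_if_vertex_angle_acute[of B C A]
    by (simp_all add: acute_triangle_def triangle_angles_def inner_commute)
  have min: "min_inscribed B C A E F D" "min_inscribed C A B F D E"
    using assms(2) min_inscribed_rotate by blast+
  \<comment> \<open>The second and third instances treat the corners E and F by rotating the
    labels.\<close>
  note corners = min_inscribed_corner[OF nc(1) pos assms(2)]
    min_inscribed_corner[OF nc(2) pos(2,3,1) min(1)]
    min_inscribed_corner[OF nc(3) pos(3,1,2) min(2)]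
  have "\<not> (vertex_angle C A B = pi / 4 \<and> vertex_angle A B C = pi / 4)"
    "\<not> (vertex_angle A B C = pi / 4 \<and> vertex_angle B C A = pi / 4)"
    "\<not> (vertex_angle B C A = pi / 4 \<and> vertex_angle C A B = pi / 4)"
    using not_two_pi_quarter[OF pos] not_two_pi_quarter[OF pos(2,3,1)]
      not_two_pi_quarter[OF pos(3,1,2)] by blast+
  \<comment> \<open>As at most one angle equals pi/4, the filtered list has length 1 as soon as some
    angle does.\<close>
  then have one: "length (filter (\<lambda>\<theta>. \<theta> = pi / 4) (triangle_angles A B C)) = 1 \<longleftrightarrow>
      vertex_angle C A B = pi / 4 \<or> vertex_angle A B C = pi / 4 \<or> vertex_angle B C A = pi / 4"
    by (auto simp: triangle_angles_def)
  have "right_triangle D E F \<longleftrightarrow>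
      vertex_angle F D E = pi / 2 \<or> vertex_angle D E F = pi / 2 \<or> vertex_angle E F D = pi / 2"
    using corners by (auto simp: right_triangle_def triangle_angles_def)
  then show ?thesis
    using one corners by blast
qed

end
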